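(* Let $(T,\vdash,\dashv,\perp)$ be a finite-dimensional triassociative algebra. For $t\in T$ let $\lambda_t^{\perp}:T\to T$ be the linear map $\lambda_t^{\perp}(x)=t\perp x$. Then $T$ is nilpotent if and only if $\lambda_t^{\perp}$ is a nilpotent endomorphism of $T$ for every $t\in T$.
   Context: A triassociative algebra $(T,\vdash,\dashv,\perp)$ is a vector space $T$ over a field with three bilinear products $\vdash,\dashv,\perp:T\times T\to T$ satisfying, for all $x,y,z\in T$: (A1) $(x\vdash y)\vdash z=x\vdash(y\vdash z)$; (A2) $(x\dashv y)\dashv z=x\dashv(y\dashv z)$; (D1) $(x\dashv y)\vdash z=x\vdash(y\vdash z)$; (D2) $(x\dashv y)\dashv z=x\dashv(y\vdash z)$; (S1) $(x\vdash y)\dashv z=x\vdash(y\dashv z)$; (T1) $(x\perp y)\vdash z=x\vdash(y\vdash z)$; (T2) $(x\dashv y)\dashv z=x\dashv(y\perp z)$; (T3) $(x\vdash y)\perp z=x\vdash(y\perp z)$; (T4) $(x\perp y)\dashv z=x\perp(y\dashv z)$; (S2) $(x\dashv y)\perp z=x\perp(y\vdash z)$; (A3) $(x\perp y)\perp z=x\perp(y\perp z)$. For subspaces $A,B\subseteq T$ and $\ast\in\{\vdash,\dashv,\perp\}$, $A\ast B$ is the span of all $a\ast b$ with $a\in A$, $b\in B$, and $A\lozenge B=A\vdash B+A\dashv B+A\perp B$. Set $T^1=T$ and $T^{n+1}=T^1\lozenge T^n+T^2\lozenge T^{n-1}+\cdots+T^n\lozenge T^1$ for $n\ge 1$. $T$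 is nilpotent if $T^n=0$ for some $n\in\mathbb{N}$. A linear endomorphism $\lambda$ is nilpotent if its $n$-fold composite $\lambda\circ\cdots\circ\lambda$ is $0$ for some $n\in\mathbb{N}$. *)

theory Defs
  imports "HOL.Vector_Spaces" "HOL-Library.Set_Algebras"
begin

text \<open>The underlying vector space is the whole type \<open>'a\<close>.\<close>

locale triassociative_algebra = vector_space scale
  for scale :: "'k::field \<Rightarrow> 'a::ab_group_add \<Rightarrow> 'a" +
  fixes lprod :: "'a \<Rightarrow> 'a \<Rightarrow> 'a"  (infixl \<open>\<turnstile>\<close> 70)
    and rprod :: "'a \<Rightarrow> 'a \<Rightarrow> 'a"  (infixl \<open>\<stileturn>\<close> 70)
    and mprod :: "'a \<Rightarrow> 'a \<Rightarrow> 'a"  (infixl \<open>\<bottom>\<close> 70)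
  assumes lprod_linear_right: "Vector_Spaces.linear scale scale (\<lambda>y. x \<turnstile> y)"
    and lprod_linear_left: "Vector_Spaces.linear scale scale (\<lambda>x. x \<turnstile> y)"
    and rprod_linear_right: "Vector_Spaces.linear scale scale (\<lambda>y. x \<stileturn> y)"
    and rprod_linear_left: "Vector_Spaces.linear scale scale (\<lambda>x. x \<stileturn> y)"
    and mprod_linear_right: "Vector_Spaces.linear scale scale (\<lambda>y. x \<bottom> y)"
    and mprod_linear_left: "Vector_Spaces.linear scale scale (\<lambda>x. x \<bottom> y)"
    and A1: "(x \<turnstile> y) \<turnstile> z = x \<turnstile> (y \<turnstile> z)"
    and A2: "(x \<stileturn> y) \<stileturn> z = x \<stileturn> (y \<stileturn> z)"
    and D1: "(x \<stileturn> y) \<turnstile> z = x \<turnstile> (y \<turnstile> z)"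
    and D2: "(x \<stileturn> y) \<stileturn> z = x \<stileturn> (y \<turnstile> z)"
    and S1: "(x \<turnstile> y) \<stileturn> z = x \<turnstile> (y \<stileturn> z)"
    and T1: "(x \<bottom> y) \<turnstile> z = x \<turnstile> (y \<turnstile> z)"
    and T2: "(x \<stileturn> y) \<stileturn> z = x \<stileturn> (y \<bottom> z)"
    and T3: "(x \<turnstile> y) \<bottom> z = x \<turnstile> (y \<bottom> z)"
    and T4: "(x \<bottom> y) \<stileturn> z = x \<bottom> (y \<stileturn> z)"
    and S2: "(x \<stileturn> y) \<bottom> z = x \<bottom> (y \<turnstile> z)"
    and A3: "(x \<bottom> y) \<bottom> z = x \<bottom> (y \<bottom> z)"
begin

definition span_prod :: "('a \<Rightarrow> 'a \<Rightarrow> 'a) \<Rightarrow> 'a set \<Rightarrow> 'a set \<Rightarrow> 'a set" where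
  "span_prod f A B = span {f a b |a b. a \<in> A \<and> b \<in> B}"

text \<open>Here and in \<open>tri_power\<close>, \<open>+\<close> and \<open>\<Sum>\<close> on sets are the elementwise operations of
  \<open>Set_Algebras\<close>, that is, sums of subspaces.\<close>

definition lozenge_prod :: "'a set \<Rightarrow> 'a set \<Rightarrow> 'a set"  (infixl \<open>\<lozenge>\<close> 70) where
  "A \<lozenge> B = span_prod (\<turnstile>) A B + span_prod (\<stileturn>) A B + span_prod (\<bottom>) A B"

text \<open>Powers are indexed from 1; the value at 0 is a dummy.\<close>

fun tri_power :: "nat \<Rightarrow> 'a set" where
  "tri_power 0 = UNIV"
| "tri_power (Suc 0) = UNIV"
| "tri_power (Suc (Suc m)) = (\<Sum>i = 1..Suc m. tri_power i \<lozenge> tri_power (Suc (Suc m) - i))"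

definition nilpotent :: bool where
  "nilpotent \<longleftrightarrow> (\<exists>n\<ge>1. tri_power n = {0})"

end

definition nilpotent_endo :: "('a::zero \<Rightarrow> 'a) \<Rightarrow> bool" where
  "nilpotent_endo f \<longleftrightarrow> (\<exists>n\<ge>1. f ^^ n = (\<lambda>x. 0))"

end

theory Submission imports Defs begin

text \<open>
  If \<open>T\<^sup>n = 0\<close>, then \<open>n\<close> applications of \<open>t \<bottom> _\<close> give zero, because \<open>t \<bottom> T\<^sup>k\<close> is
  contained in the summand \<open>T\<^sup>1 \<lozenge> T\<^sup>k\<close> of \<open>T\<^sup>k\<^sup>+\<^sup>1\<close>. The converse reduces to the associative
  algebra \<open>(T, \<bottom>)\<close> and to the multiplication operators
  \<open>L\<^sub>a = (a \<turnstile> _)\<close>, \<open>M\<^sub>a = (a \<bottom> _)\<close> and \<open>R\<^sub>a = (_ \<stileturn> a)\<close>.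

  The maps \<open>M\<^sub>a\<close> form a linear space of nilpotent operators on a finite-dimensional space that is
  closed under composition. By a theorem of Wedderburn (\<open>nil_operators_vanishing_words\<close>), all
  compositions of \<open>n\<close> of them vanish for some \<open>n\<close>. Since \<open>L\<^sub>a \<circ> L\<^sub>b = L\<^sub>c\<close> and
  \<open>R\<^sub>b \<circ> R\<^sub>a = R\<^sub>c\<close> for \<open>c = a \<bottom> b\<close>, every composition of sufficiently many \<open>L\<close>'s, or of
  sufficiently many \<open>R\<close>'s, is multiplication by a long \<open>\<bottom>\<close>-product and hence vanishes too.

  For mixed words in the \<open>L\<close>'s and \<open>M\<close>'s, the rule \<open>L\<^sub>a \<circ> M\<^sub>b = M\<^sub>c\<close> with \<open>c = a \<turnstile> b\<close> lets
  each \<open>M\<close> absorb the \<open>L\<close>'s in front of it. A word of length \<open>N * N\<close> therefore either contains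
  \<open>N\<close> consecutive \<open>L\<close>'s or produces a \<open>\<bottom>\<close>-product with \<open>N\<close> left factors; it vanishes in both
  cases (\<open>vanishing_left_mid_words\<close>).

  Finally, the axioms bring every iterated product of \<open>n\<close> letters into the form \<open>f (g x)\<close>, where
  \<open>x\<close> is a letter, \<open>g\<close> is a word in the \<open>R\<close>'s, \<open>f\<close> is a word in the \<open>L\<close>'s and \<open>M\<close>'s, and their
  lengths add up to \<open>n - 1\<close> (\<open>monomial_normal_form\<close>). For large \<open>n\<close> one of the two words is so
  long that it vanishes. The iterated products of \<open>n\<close> letters span a space that contains \<open>T\<^sup>n\<close>,
  so \<open>T\<^sup>n = 0\<close>.
\<close>

section \<open>Words of operators\<close>

primrec comp_words :: "('a \<Rightarrow> 'a) set \<Rightarrow> nat \<Rightarrow> ('a \<Rightarrow> 'a) set" where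
  "comp_words S 0 = {id}"
| "comp_words S (Suc n) = {f \<circ> g |f g. f \<in> S \<and> g \<in> comp_words S n}"

lemma comp_words_Suc_intro:
  "f \<in> S \<Longrightarrow> g \<in> comp_words S n \<Longrightarrow> f \<circ> g \<in> comp_words S (Suc n)"
  by auto

lemma comp_words_one: "f \<in> S \<Longrightarrow> f \<in> comp_words S (Suc 0)"
  by simp

lemma comp_words_comp:
  "f \<in> comp_words S m \<Longrightarrow> g \<in> comp_words S n \<Longrightarrow> f \<circ> g \<in> comp_words S (m + n)"
proof (induction m arbitrary: f)
  case (Suc m)
  then obtain h k where "f = h \<circ> k" "h \<in> S" "k \<in> comp_words S m" by auto
  then have "h \<circ> (k \<circ> g) \<in> comp_words S (Suc (m + n))"
    by (intro comp_words_Suc_intro Suc.IH Suc.prems(2))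
  then show ?case using \<open>f = h \<circ> k\<close> by (simp only: comp_assoc add_Suc)
qed simp

lemma comp_words_split:
  "f \<in> comp_words S (m + n) \<Longrightarrow> \<exists>g\<in>comp_words S m. \<exists>h\<in>comp_words S n. f = g \<circ> h"
proof (induction m arbitrary: f)
  case (Suc m)
  then obtain a k where f: "f = a \<circ> k" "a \<in> S" "k \<in> comp_words S (m + n)" by auto
  from Suc.IH[OF f(3)] obtain g h
    where "g \<in> comp_words S m" "h \<in> comp_words S n" "k = g \<circ> h" by blast
  then show ?case using f(1,2) comp_words_Suc_intro[of a S g m] by (metis comp_assoc)
qed simp

lemma comp_words_SucE:
  assumes "f \<in> comp_words S (Suc n)"
  obtains g h where "g \<in> comp_words S n" "h \<in> S" "f = g \<circ> h"
  using comp_words_split[of f S n 1] assms that by auto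

lemma comp_words_mono: "S \<subseteq> S' \<Longrightarrow> comp_words S n \<subseteq> comp_words S' n"
  by (induction n) auto

definition vanishing_words :: "('a::zero \<Rightarrow> 'a) set \<Rightarrow> nat \<Rightarrow> bool" where
  "vanishing_words S n \<longleftrightarrow> (\<forall>f\<in>comp_words S n. \<forall>x. f x = 0)"

text \<open>Already the outermost \<open>m\<close> operators of the word compose to zero.\<close>

lemma vanishing_words_le:
  assumes "vanishing_words S m" "m \<le> n"
  shows "vanishing_words S n"
  unfolding vanishing_words_def
proof (intro ballI allI)
  fix f x assume "f \<in> comp_words S n"
  then have "f \<in> comp_words S (m + (n - m))" using assms(2) by simp
  from comp_words_split[OF this] show "f x = 0"
    using assms(1) unfolding vanishing_words_def by auto
qed

section \<open>Spaces of nilpotent operators closed under composition\<close>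

context finite_dimensional_vector_space
begin

text \<open>Let \<open>U\<close> be the space of all vectors killed by all words of length \<open>k\<close>, where \<open>k\<close> is chosen so
  that this space has maximal dimension. Then every vector that \<open>S\<close> maps into \<open>U\<close> is itself in \<open>U\<close>.
  If \<open>U\<close> were a proper subspace, there would be a minimal \<open>S\<close>-invariant subspace \<open>I\<close> properly
  containing \<open>U\<close>. For \<open>x \<in> I\<close>, the space \<open>J = U + S x\<close> is invariant and lies between \<open>U\<close> and
  \<open>I\<close>. If \<open>J = I\<close>, then \<open>x\<close> is congruent to \<open>g x\<close> modulo \<open>U\<close> for some \<open>g \<in> S\<close>, hence to all
  \<open>g\<^sup>n x\<close>, and the nilpotency of \<open>g\<close> puts \<open>x\<close> into \<open>U\<close>. Otherwise \<open>J = U\<close>. In both cases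
  \<open>S x \<subseteq> U\<close>; so \<open>S\<close> maps \<open>I\<close> into \<open>U\<close> and \<open>I \<subseteq> U\<close>, a contradiction.\<close>

theorem nil_operators_vanishing_words:
  fixes S :: "('b \<Rightarrow> 'b) set"
  assumes linear: "\<And>f. f \<in> S \<Longrightarrow> Vector_Spaces.linear scale scale f"
    and comp: "\<And>f g. f \<in> S \<Longrightarrow> g \<in> S \<Longrightarrow> f \<circ> g \<in> S"
    and orbit: "\<And>x. subspace ((\<lambda>f. f x) ` S)"
    and nil: "\<And>f. f \<in> S \<Longrightarrow> nilpotent_endo f"
  shows "\<exists>n. vanishing_words S n"
proof -
  have hom: "module_hom scale scale f" if "f \<in> S" for f
    using linear[OF that] by (simp add: linear_iff_module_hom)
  note S_add = module_hom.add[OF hom] and S_zero = module_hom.zero[OF hom]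
    and S_diff = module_hom.diff[OF hom]
  have word_hom: "module_hom scale scale f" if "f \<in> comp_words S n" for f n
    using that
  proof (induction n arbitrary: f)
    case 0
    then have "f = id" by simp
    then show ?case using linear_id by (simp only: linear_iff_module_hom)
  next
    case (Suc n) then show ?case using hom module_hom_compose by fastforce
  qed
  define W where "W n = {x. \<forall>f\<in>comp_words S n. f x = 0}" for n
  have sub_W: "subspace (W n)" for n
  proof (rule subspaceI)
    show "0 \<in> W n"
      unfolding W_def using module_hom.zero[OF word_hom] by blast
    show "x + y \<in> W n" if "x \<in> W n" "y \<in> W n" for x y
      using that unfolding W_def by (auto simp: module_hom.add[OF word_hom[of _ n]])
    show "scale c x \<in> W n" if "x \<in> W n" for c x
      using that unfolding W_def by (auto simp: module_hom.scale[OF word_hom[of _ n]])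
  qed
  have W_mono: "W n \<subseteq> W (Suc n)" for n
    unfolding W_def using S_zero by auto
  have W_step: "f x \<in> W n" if "x \<in> W (Suc n)" "f \<in> S" for f x n
    using that comp_words_comp[of _ S n f 1] unfolding W_def by fastforce
  have W_stepI: "x \<in> W (Suc n)" if "\<And>f. f \<in> S \<Longrightarrow> f x \<in> W n" for x n
    using that unfolding W_def by (auto elim!: comp_words_SucE simp del: comp_words.simps)
  \<comment> \<open>The kernels \<open>W n\<close> increase with \<open>n\<close>, so maximal dimension at \<open>k\<close> means that they are
    stationary from \<open>k\<close> on.\<close>
  obtain k where k: "\<And>n. dim (W n) \<le> dim (W k)"
    using ex_has_greatest_nat[of "\<lambda>_. True" 0 "\<lambda>n. dim (W n)" "Suc dimension"] le_imp_less_Suc[OF dim_subset_UNIV]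
    by blast
  define U where "U = W k"
  have U_sub: "subspace U" unfolding U_def by (rule sub_W)
  have U_eq: "W (Suc k) = U"
    unfolding U_def using subspace_dim_equal[OF sub_W sub_W W_mono k] by simp
  have U_inv: "f x \<in> U" if "x \<in> U" "f \<in> S" for f x
    using W_step[of x k f] that U_eq U_def by simp
  have "U = UNIV"
  proof (rule ccontr)
    assume "U \<noteq> UNIV"
    define inv where "inv I \<longleftrightarrow> subspace I \<and> U \<subset> I \<and> (\<forall>f\<in>S. \<forall>x\<in>I. f x \<in> I)" for I
    have "inv UNIV" using \<open>U \<noteq> UNIV\<close> unfolding inv_def by auto
    from ex_has_least_nat[of inv, OF this, of dim]
    obtain I where I: "inv I" and I_min: "\<And>J. inv J \<Longrightarrow> dim I \<le> dim J" by blast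
    have step: "f x \<in> U" if x: "x \<in> I" and f: "f \<in> S" for f x
    proof -
      define J where "J = {u + v |u v. u \<in> U \<and> v \<in> (\<lambda>g. g x) ` S}"
      have J_sub: "subspace J" unfolding J_def by (rule subspace_sums[OF U_sub orbit])
      have mem_J: "u + g x \<in> J" if "u \<in> U" "g \<in> S" for u g
        using that unfolding J_def by blast
      have UJ: "U \<subseteq> J"
        using subspace_0[OF orbit[of x]] unfolding J_def by force
      have SJ: "g x \<in> J" if "g \<in> S" for g
        using mem_J[OF subspace_0[OF U_sub] that] by simp
      have JI: "J \<subseteq> I"
        using I x subspace_add unfolding J_def inv_def by blast
      have J_inv: "g y \<in> J" if g: "g \<in> S" and y: "y \<in> J" for g y
      proof -
        from y obtain u h where "u \<in> U" "h \<in> S" "y = u + h x" unfolding J_def by blast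
        then show ?thesis
          using mem_J[OF U_inv[of u g] comp[of g h]] g S_add[OF g] by simp
      qed
      show "f x \<in> U"
      proof (cases "J = U")
        case True then show ?thesis using SJ f by auto
      next
        case False
        then have "inv J" using UJ J_sub J_inv unfolding inv_def by auto
        from subspace_dim_equal[OF J_sub _ JI I_min[OF this]] have "J = I"
          using I unfolding inv_def by simp
        with x have "x \<in> J" by simp
        then obtain u g where u: "u \<in> U" and g: "g \<in> S" and xeq: "x = u + g x"
          unfolding J_def by auto
        have "x - (g ^^ n) x \<in> U" for n
        proof (induction n)
          case 0 then show ?case using subspace_0[OF U_sub] by simp
        next
          case (Suc n)
          have "x - (g ^^ Suc n) x = u + g (x - (g ^^ n) x)"
            using xeq S_diff[OF g] by (simp add: algebra_simps)
          then show ?case using subspace_add[OF U_sub u U_inv[OF Suc g]] by simp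
        qed
        moreover obtain n where "g ^^ n = (\<lambda>x. 0)"
          using nil[OF g] unfolding nilpotent_endo_def by blast
        ultimately have "x \<in> U" by (metis diff_zero)
        then show ?thesis using U_inv f by blast
      qed
    qed
    have "I \<subseteq> W (Suc k)" using W_stepI step unfolding U_def by blast
    then show False using I U_eq unfolding inv_def by blast
  qed
  then show ?thesis unfolding U_def W_def vanishing_words_def by blast
qed

end

section \<open>Multiplication operators of a triassociative algebra\<close>

context triassociative_algebra
begin

abbreviation left_ops where "left_ops \<equiv> range (\<turnstile>)"
abbreviation right_ops where "right_ops \<equiv> range (\<lambda>d x. x \<stileturn> d)"
abbreviation mid_ops where "mid_ops \<equiv> range (\<bottom>)"

lemma
  shows mprod_add_left: "(x + y) \<bottom> z = x \<bottom> z + y \<bottom> z"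
    and mprod_scale_left: "scale c x \<bottom> z = scale c (x \<bottom> z)"
  using mprod_linear_left unfolding linear_iff_module_hom module_hom_iff by blast+

lemma zero_lprod: "0 \<turnstile> x = 0"
  using lprod_linear_left module_hom.zero unfolding linear_iff_module_hom by blast

lemma rprod_zero: "x \<stileturn> 0 = 0"
  using rprod_linear_right module_hom.zero unfolding linear_iff_module_hom by blast

lemma zero_mprod: "0 \<bottom> x = 0"
  using mprod_linear_left module_hom.zero unfolding linear_iff_module_hom by blast

lemma mprod_zero: "x \<bottom> 0 = 0"
  using mprod_linear_right module_hom.zero unfolding linear_iff_module_hom by blast

lemma subspace_mprod_orbit: "subspace ((\<lambda>f. f x) ` mid_ops)"
proof -
  have "(\<lambda>f. f x) ` mid_ops = {a \<bottom> x |a. True}" by auto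
  then show ?thesis
    unfolding subspace_def
    by (auto simp flip: mprod_add_left mprod_scale_left) (metis zero_mprod)
qed

text \<open>A composition of left multiplications is again one, and axiom (T1) allows the multiplier to be
  written with \<open>\<bottom>\<close> only; a vanishing statement for \<open>\<bottom>\<close> thus carries over to \<open>\<turnstile>\<close>. One letter
  of the word becomes the argument \<open>c\<close>, which explains the shift by one.\<close>

lemma left_word_is_lprod:
  "f \<in> comp_words left_ops (Suc n) \<Longrightarrow>
    \<exists>g\<in>comp_words mid_ops n. \<exists>c. f = (\<turnstile>) (g c)"
proof (induction n arbitrary: f)
  case (Suc n)
  from Suc.prems obtain a h where f: "f = (\<turnstile>) a \<circ> h" and "h \<in> comp_words left_ops (Suc n)"
    by (subst (asm) comp_words.simps(2)) blast
  then obtain g c where g: "g \<in> comp_words mid_ops n" and h: "h = (\<turnstile>) (g c)"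
    using Suc.IH by blast
  have "f = (\<turnstile>) (((\<bottom>) a \<circ> g) c)" using f h by (auto simp: T1)
  then show ?case using comp_words_Suc_intro[OF rangeI g] by blast
qed auto

text \<open>The mirror image, by (T2). Right multiplications compose in reversed order, so the new
  \<open>\<bottom>\<close>-factor comes from the innermost operator of the word.\<close>

lemma right_word_is_rprod:
  "f \<in> comp_words right_ops (Suc n) \<Longrightarrow>
    \<exists>g\<in>comp_words mid_ops n. \<exists>c. f = (\<lambda>x. x \<stileturn> g c)"
proof (induction n arbitrary: f)
  case (Suc n)
  from Suc.prems obtain a h
    where f: "f = h \<circ> (\<lambda>x. x \<stileturn> a)" and "h \<in> comp_words right_ops (Suc n)"
    by (rule comp_words_SucE) blast
  then obtain g c where g: "g \<in> comp_words mid_ops n" and h: "h = (\<lambda>x. x \<stileturn> g c)"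
    using Suc.IH by blast
  have "f = (\<lambda>x. x \<stileturn> ((\<bottom>) a \<circ> g) c)" using f h by (auto simp: T2)
  then show ?case using comp_words_Suc_intro[OF rangeI g] by blast
qed auto

section \<open>Mixed words of left and middle multiplications\<close>

lemma vanishing_left_words:
  "vanishing_words mid_ops n \<Longrightarrow> vanishing_words left_ops (Suc n)"
  unfolding vanishing_words_def by (metis left_word_is_lprod zero_lprod)

lemma vanishing_right_words:
  "vanishing_words mid_ops n \<Longrightarrow> vanishing_words right_ops (Suc n)"
  unfolding vanishing_words_def by (metis right_word_is_rprod rprod_zero)

text \<open>These are the products \<open>y\<^sub>1 \<bottom> (\<dots> \<bottom> (y\<^sub>r \<bottom> z))\<close> themselves and not their span: left and middle
  multiplications send such a product to another one, so linear combinations never arise.\<close>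

definition mid_power :: "nat \<Rightarrow> 'a set" where
  "mid_power r = {g z |g z. g \<in> comp_words mid_ops r}"

lemma mid_power_0: "mid_power 0 = UNIV"
  unfolding mid_power_def by simp

lemma mprod_mid_power: "z \<in> mid_power r \<Longrightarrow> a \<bottom> z \<in> mid_power (Suc r)"
  unfolding mid_power_def using comp_words_Suc_intro[of "(\<bottom>) a" mid_ops] by fastforce

lemma mid_power_SucE:
  assumes "z \<in> mid_power (Suc r)"
  obtains y w where "z = y \<bottom> w" "w \<in> mid_power r"
proof -
  from assms obtain f x where "z = f x" "f \<in> comp_words mid_ops (Suc r)"
    unfolding mid_power_def by blast
  then obtain y g where "z = y \<bottom> g x" "g \<in> comp_words mid_ops r" by auto
  then show ?thesis using that unfolding mid_power_def by blast
qed

text \<open>Both kinds of operator can be absorbed into the first factor \<open>y\<^sub>1\<close>, by (A3) and by (T3).\<close>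

lemma mprod_mid_power_same: "z \<in> mid_power r \<Longrightarrow> a \<bottom> z \<in> mid_power r"
  by (cases r) (auto simp: mid_power_0 mprod_mid_power elim!: mid_power_SucE simp flip: A3)

lemma lprod_mid_power: "z \<in> mid_power r \<Longrightarrow> a \<turnstile> z \<in> mid_power r"
  by (cases r) (auto simp: mid_power_0 mprod_mid_power elim!: mid_power_SucE simp flip: T3)

lemma word_mid_power:
  "f \<in> comp_words (left_ops \<union> mid_ops) p \<Longrightarrow> z \<in> mid_power r \<Longrightarrow> f z \<in> mid_power r"
  by (induction p arbitrary: f) (auto simp: lprod_mid_power mprod_mid_power_same)

text \<open>The first \<open>M\<close> met in the word, read from the inside, contributes a new \<open>\<bottom>\<close>-factor, which the
  later operators preserve.\<close>

lemma word_raises_mid_power: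
  "f \<in> comp_words (left_ops \<union> mid_ops) p \<Longrightarrow> z \<in> mid_power r \<Longrightarrow>
    f \<in> comp_words left_ops p \<or> f z \<in> mid_power (Suc r)"
proof (induction p arbitrary: f)
  case (Suc p)
  then obtain h k where f: "f = h \<circ> k" and h: "h \<in> left_ops \<union> mid_ops"
    and k: "k \<in> comp_words (left_ops \<union> mid_ops) p" by auto
  from h show ?case
  proof
    assume "h \<in> left_ops"
    from Suc.IH[OF k Suc.prems(2)] show ?thesis
    proof
      assume "k \<in> comp_words left_ops p"
      then show ?thesis unfolding f using \<open>h \<in> left_ops\<close> comp_words_Suc_intro by blast
    next
      assume "k z \<in> mid_power (Suc r)"
      then show ?thesis using f \<open>h \<in> left_ops\<close> lprod_mid_power by auto
    qed
  next
    assume "h \<in> mid_ops"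
    then show ?thesis
      using word_mid_power[OF k Suc.prems(2)] f mprod_mid_power by auto
  qed
qed simp

text \<open>Cut the word into \<open>r\<close> blocks of length \<open>N\<close>. Each block yields a new \<open>\<bottom>\<close>-factor unless it
  consists of \<open>L\<close>'s only; but then it is zero.\<close>

lemma long_word_mid_power:
  assumes "vanishing_words left_ops N"
  shows "f \<in> comp_words (left_ops \<union> mid_ops) (r * N) \<Longrightarrow> f z \<in> mid_power r"
proof (induction r arbitrary: f)
  case 0 then show ?case by (simp add: mid_power_0)
next
  case (Suc r)
  then have "f \<in> comp_words (left_ops \<union> mid_ops) (N + r * N)" by simp
  then obtain g h where g: "g \<in> comp_words (left_ops \<union> mid_ops) N"
    and h: "h \<in> comp_words (left_ops \<union> mid_ops) (r * N)" and f: "f = g \<circ> h"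
    using comp_words_split by blast
  have hz: "h z \<in> mid_power r" by (rule Suc.IH[OF h])
  from word_raises_mid_power[OF g hz] show ?case
  proof
    assume "g \<in> comp_words left_ops N"
    \<comment> \<open>Zero belongs to \<open>mid_power (Suc r)\<close> as the product of \<open>0\<close> with an element of
      \<open>mid_power r\<close>.\<close>
    then have "f z = 0 \<bottom> h z" using assms f unfolding vanishing_words_def by (simp add: zero_mprod)
    then show ?thesis using mprod_mid_power[OF hz] by simp
  qed (simp add: f)
qed

lemma vanishing_left_mid_words:
  assumes "vanishing_words left_ops N" "vanishing_words mid_ops N"
  shows "vanishing_words (left_ops \<union> mid_ops) (N * N)"
  unfolding vanishing_words_def
proof (intro ballI allI)
  fix f z assume "f \<in> comp_words (left_ops \<union> mid_ops) (N * N)"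
  then have "f z \<in> mid_power N" by (rule long_word_mid_power[OF assms(1)])
  then show "f z = 0" using assms(2) unfolding mid_power_def vanishing_words_def by auto
qed

section \<open>Normal form of iterated products\<close>

inductive monomial :: "nat \<Rightarrow> 'a \<Rightarrow> bool" where
  letter: "monomial (Suc 0) x"
| left: "monomial i u \<Longrightarrow> monomial j v \<Longrightarrow> monomial (i + j) (u \<turnstile> v)"
| right: "monomial i u \<Longrightarrow> monomial j v \<Longrightarrow> monomial (i + j) (u \<stileturn> v)"
| mid: "monomial i u \<Longrightarrow> monomial j v \<Longrightarrow> monomial (i + j) (u \<bottom> v)"

text \<open>By (A1), (D1) and (T1), the left multiplication by a product does not depend on which of the three
  products is used, so the left multiplication by a monomial is the composition of those by its
  letters. Axioms (A2), (D2) and (T2) give the same for right multiplications.\<close>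

lemma lprod_monomial: "monomial n u \<Longrightarrow> (\<turnstile>) u \<in> comp_words left_ops n"
proof (induction rule: monomial.induct)
  case (left i u j v)
  have "(\<turnstile>) (u \<turnstile> v) = (\<turnstile>) u \<circ> (\<turnstile>) v" by (auto simp: A1)
  then show ?case using comp_words_comp left.IH by metis
next
  case (right i u j v)
  have "(\<turnstile>) (u \<stileturn> v) = (\<turnstile>) u \<circ> (\<turnstile>) v" by (auto simp: D1)
  then show ?case using comp_words_comp right.IH by metis
next
  case (mid i u j v)
  have "(\<turnstile>) (u \<bottom> v) = (\<turnstile>) u \<circ> (\<turnstile>) v" by (auto simp: T1)
  then show ?case using comp_words_comp mid.IH by metis
qed (auto intro: comp_words_one)

lemma rprod_monomial: "monomial n u \<Longrightarrow> (\<lambda>x. x \<stileturn> u) \<in> comp_words right_ops n"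
proof (induction rule: monomial.induct)
  case (left i u j v)
  have "(\<lambda>x. x \<stileturn> (u \<turnstile> v)) = (\<lambda>x. x \<stileturn> v) \<circ> (\<lambda>x. x \<stileturn> u)" by (auto simp: D2)
  then show ?case using comp_words_comp[OF left.IH(2,1)] by (simp add: add.commute)
next
  case (right i u j v)
  have "(\<lambda>x. x \<stileturn> (u \<stileturn> v)) = (\<lambda>x. x \<stileturn> v) \<circ> (\<lambda>x. x \<stileturn> u)" by (auto simp: A2)
  then show ?case using comp_words_comp[OF right.IH(2,1)] by (simp add: add.commute)
next
  case (mid i u j v)
  have "(\<lambda>x. x \<stileturn> (u \<bottom> v)) = (\<lambda>x. x \<stileturn> v) \<circ> (\<lambda>x. x \<stileturn> u)" by (auto simp: T2)
  then show ?case using comp_words_comp[OF mid.IH(2,1)] by (simp add: add.commute)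
qed (auto intro: comp_words_one)

lemma lprod_monomial_left_mid:
  "monomial n u \<Longrightarrow> (\<turnstile>) u \<in> comp_words (left_ops \<union> mid_ops) n"
  using lprod_monomial comp_words_mono[of left_ops "left_ops \<union> mid_ops"] by blast

text \<open>By (T3), (S2) and (A3) the operator \<open>M\<close> of a product of \<open>u\<close> and \<open>v\<close> is \<open>L\<^sub>u \<circ> M\<^sub>v\<close>,
  \<open>M\<^sub>u \<circ> L\<^sub>v\<close> or \<open>M\<^sub>u \<circ> M\<^sub>v\<close>, which is why left multiplications have to be allowed in the
  word.\<close>

lemma mprod_monomial: "monomial n u \<Longrightarrow> (\<bottom>) u \<in> comp_words (left_ops \<union> mid_ops) n"
proof (induction rule: monomial.induct)
  case (left i u j v)
  have "(\<bottom>) (u \<turnstile> v) = (\<turnstile>) u \<circ> (\<bottom>) v" by (auto simp: T3)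
  then show ?case using comp_words_comp lprod_monomial_left_mid[OF left.hyps(1)] left.IH by metis
next
  case (right i u j v)
  have "(\<bottom>) (u \<stileturn> v) = (\<bottom>) u \<circ> (\<turnstile>) v" by (auto simp: S2)
  then show ?case using comp_words_comp lprod_monomial_left_mid[OF right.hyps(2)] right.IH by metis
next
  case (mid i u j v)
  have "(\<bottom>) (u \<bottom> v) = (\<bottom>) u \<circ> (\<bottom>) v" by (auto simp: A3)
  then show ?case using comp_words_comp mid.IH by metis
qed (auto intro: comp_words_one)

lemma word_rprod_commute:
  "f \<in> comp_words (left_ops \<union> mid_ops) p \<Longrightarrow> f x \<stileturn> d = f (x \<stileturn> d)"
  by (induction p arbitrary: f) (auto simp: S1 T4)

text \<open>In a product of type \<open>\<turnstile>\<close> or \<open>\<bottom>\<close> the left factor acts on the normal form of the right one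
  from outside. In \<open>u \<stileturn> v\<close> the right factor acts on the normal form \<open>f (g x)\<close> of \<open>u\<close>, and
  \<open>R\<^sub>v\<close> commutes past \<open>f\<close> to join \<open>g\<close>.\<close>

lemma monomial_normal_form:
  "monomial n u \<Longrightarrow> \<exists>p q f g x. n = Suc (p + q) \<and> f \<in> comp_words (left_ops \<union> mid_ops) p \<and>
    g \<in> comp_words right_ops q \<and> u = f (g x)"
proof (induction rule: monomial.induct)
  case (letter x)
  have "Suc 0 = Suc (0 + 0)" "id \<in> comp_words S 0" "x = id (id x)" for S :: "('a \<Rightarrow> 'a) set"
    by (simp_all only: comp_words.simps singleton_iff id_apply add_0)
  then show ?case by blast
next
  case (left i u j v)
  then obtain p q f g x where v: "j = Suc (p + q)" "f \<in> comp_words (left_ops \<union> mid_ops) p"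
    "g \<in> comp_words right_ops q" "v = f (g x)" by blast
  have "(\<turnstile>) u \<circ> f \<in> comp_words (left_ops \<union> mid_ops) (i + p)"
    by (rule comp_words_comp[OF lprod_monomial_left_mid[OF left.hyps(1)] v(2)])
  moreover have "i + j = Suc ((i + p) + q)" "u \<turnstile> v = ((\<turnstile>) u \<circ> f) (g x)" using v by auto
  ultimately show ?case using v(3) by blast
next
  case (mid i u j v)
  then obtain p q f g x where v: "j = Suc (p + q)" "f \<in> comp_words (left_ops \<union> mid_ops) p"
    "g \<in> comp_words right_ops q" "v = f (g x)" by blast
  have "(\<bottom>) u \<circ> f \<in> comp_words (left_ops \<union> mid_ops) (i + p)"
    by (rule comp_words_comp[OF mprod_monomial[OF mid.hyps(1)] v(2)])
  moreover have "i + j = Suc ((i + p) + q)" "u \<bottom> v = ((\<bottom>) u \<circ> f) (g x)" using v by auto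
  ultimately show ?case using v(3) by blast
next
  case (right i u j v)
  then obtain p q f g x where u: "i = Suc (p + q)" "f \<in> comp_words (left_ops \<union> mid_ops) p"
    "g \<in> comp_words right_ops q" "u = f (g x)" by blast
  have "(\<lambda>x. x \<stileturn> v) \<circ> g \<in> comp_words right_ops (j + q)"
    by (rule comp_words_comp[OF rprod_monomial[OF right.hyps(2)] u(3)])
  moreover have "i + j = Suc (p + (j + q))" "u \<stileturn> v = f (((\<lambda>x. x \<stileturn> v) \<circ> g) x)"
    using u word_rprod_commute by auto
  ultimately show ?case using u(2) by blast
qed

text \<open>The word lengths in the normal form add up to \<open>n - 1 \<ge> K + N - 1\<close>, so one of them reaches its
  bound \<open>K\<close> or \<open>N\<close>.\<close>

lemma long_monomial_eq_0:
  assumes "vanishing_words (left_ops \<union> mid_ops) K" "vanishing_words right_ops N"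
    and "monomial n u" "K + N \<le> n"
  shows "u = 0"
proof -
  obtain p q f g x where n: "n = Suc (p + q)" and f: "f \<in> comp_words (left_ops \<union> mid_ops) p"
    and g: "g \<in> comp_words right_ops q" and u: "u = f (g x)"
    using monomial_normal_form[OF assms(3)] by blast
  \<comment> \<open>\<open>f\<close> is linear, but commutation with \<open>R\<^sub>0 = 0\<close> gives this directly.\<close>
  have f0: "f 0 = 0"
    using word_rprod_commute[OF f, of 0 0] by (simp add: rprod_zero)
  show ?thesis
  proof (cases "K \<le> p")
    case True
    then show ?thesis using vanishing_words_le[OF assms(1)] f u unfolding vanishing_words_def by blast
  next
    case False
    then have "N \<le> q" using n assms(4) by simp
    then show ?thesis
      using vanishing_words_le[OF assms(2)] g u f0 unfolding vanishing_words_def by metis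
  qed
qed

section \<open>Powers of the algebra and nilpotency\<close>

lemma bilinear_span_mem:
  assumes "\<And>a. module_hom scale scale (f a)" "\<And>b. module_hom scale scale (\<lambda>a. f a b)"
    and mem: "\<And>u v. u \<in> X \<Longrightarrow> v \<in> Y \<Longrightarrow> f u v \<in> span Z"
    and a: "a \<in> span X" and b: "b \<in> span Y"
  shows "f a b \<in> span Z"
proof -
  have *: "f u b \<in> span Z" if u: "u \<in> X" for u
    using b
    by (induction rule: span_induct)
      (auto simp: subspace_def mem u module_hom.add[OF assms(1)] module_hom.zero[OF assms(1)]
        module_hom.scale[OF assms(1)] span_zero span_add span_scale)
  show ?thesis
    using a
    by (induction rule: span_induct)
      (auto simp: subspace_def * module_hom.add[OF assms(2)] module_hom.zero[OF assms(2)]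
        module_hom.scale[OF assms(2)] span_zero span_add span_scale)
qed

lemma sum_subset_subspace:
  assumes "subspace U" "\<And>i. i \<in> I \<Longrightarrow> A i \<subseteq> U"
  shows "sum A I \<subseteq> U"
  using assms(2)
proof (induction I rule: infinite_finite_induct)
  case (insert i I)
  then have "A i \<subseteq> U" "sum A I \<subseteq> U" by auto
  then show ?case using insert.hyps subspace_add[OF assms(1)]
    by (auto elim!: set_plus_elim)
qed (auto simp: subspace_0[OF assms(1)])

lemma tri_power_subset_span_monomials:
  "1 \<le> n \<Longrightarrow> tri_power n \<subseteq> span (Collect (monomial n))"
proof (induction n rule: tri_power.induct)
  case 2
  show ?case using span_superset letter by fastforce
next
  case (3 m)
  let ?n = "Suc (Suc m)" let ?Z = "span (Collect (monomial (Suc (Suc m))))"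
  have "tri_power i \<lozenge> tri_power (?n - i) \<subseteq> ?Z" if i: "i \<in> {1..Suc m}" for i
  proof -
    have n: "i + (?n - i) = ?n" using i by simp
    have mem: "monomial i u \<Longrightarrow> monomial (?n - i) v \<Longrightarrow> monomial ?n (u \<turnstile> v)"
       "monomial i u \<Longrightarrow> monomial (?n - i) v \<Longrightarrow> monomial ?n (u \<stileturn> v)"
       "monomial i u \<Longrightarrow> monomial (?n - i) v \<Longrightarrow> monomial ?n (u \<bottom> v)" for u v
      using left[of i u "?n - i" v] right[of i u "?n - i" v] mid[of i u "?n - i" v]
      unfolding n by auto
    have IH: "tri_power i \<subseteq> span (Collect (monomial i))"
      "tri_power (?n - i) \<subseteq> span (Collect (monomial (?n - i)))"
      using 3(1)[OF i] 3(2)[OF i] i by (auto simp: Suc_diff_le)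
    have prod: "span_prod f (tri_power i) (tri_power (?n - i)) \<subseteq> ?Z"
      if lin: "\<And>a. Vector_Spaces.linear scale scale (f a)"
        "\<And>b. Vector_Spaces.linear scale scale (\<lambda>a. f a b)"
        and f: "\<And>u v. monomial i u \<Longrightarrow> monomial (?n - i) v \<Longrightarrow> monomial ?n (f u v)" for f
      unfolding span_prod_def
    proof (rule span_minimal[OF _ subspace_span], clarify)
      fix a b assume "a \<in> tri_power i" "b \<in> tri_power (?n - i)"
      then have ab: "a \<in> span (Collect (monomial i))" "b \<in> span (Collect (monomial (?n - i)))"
        using IH by blast+
      show "f a b \<in> ?Z"
        by (rule bilinear_span_mem[OF lin[unfolded linear_iff_module_hom] _ ab])
          (use f span_base in blast)
    qed
    show ?thesis
      unfolding lozenge_prod_def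
      using prod[OF lprod_linear_right lprod_linear_left mem(1)]
        prod[OF rprod_linear_right rprod_linear_left mem(2)]
        prod[OF mprod_linear_right mprod_linear_left mem(3)]
      by (blast elim!: set_plus_elim intro: span_add)
  qed
  then show ?case unfolding tri_power.simps(3) by (rule sum_subset_subspace[OF subspace_span])
qed simp

lemma zero_mem_lozenge: "0 \<in> A \<lozenge> B"
  unfolding lozenge_prod_def span_prod_def
  using set_plus_intro[OF set_plus_intro[OF span_zero span_zero] span_zero] by simp

lemma zero_mem_sum:
  fixes A :: "nat \<Rightarrow> 'a set"
  assumes "\<And>i. 0 \<in> A i"
  shows "0 \<in> sum A I"
proof (induction I rule: infinite_finite_induct)
  case (insert i I)
  then show ?case using set_plus_intro[OF assms[of i] insert.IH] by simp
qed auto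

lemma tri_power_eq_0:
  assumes "vanishing_words (left_ops \<union> mid_ops) K" "vanishing_words right_ops N"
    and "1 \<le> n" "K + N \<le> n"
  shows "tri_power n = {0}"
proof
  have "Collect (monomial n) \<subseteq> {0}" using long_monomial_eq_0[OF assms(1,2)] assms(4) by blast
  then have "span (Collect (monomial n)) \<subseteq> {0}"
    by (rule span_minimal) (simp add: subspace_def)
  then show "tri_power n \<subseteq> {0}" using tri_power_subset_span_monomials[OF assms(3)] by blast
next
  show "{0} \<subseteq> tri_power n"
    by (cases n rule: tri_power.cases)
      (auto simp: zero_mem_sum zero_mem_lozenge simp del: sum.cl_ivl_Suc)
qed

text \<open>The product lies in the summand \<open>T\<^sup>1 \<lozenge> T\<^sup>n\<close> of \<open>T\<^sup>n\<^sup>+\<^sup>1\<close>; all other summands contribute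
  zero.\<close>

lemma mprod_mem_tri_power:
  assumes "1 \<le> n" "y \<in> tri_power n"
  shows "t \<bottom> y \<in> tri_power (Suc n)"
proof -
  obtain m where m: "n = Suc m" using assms(1) by (cases n) auto
  have zero: "0 \<in> (\<Sum>i\<in>I. tri_power i \<lozenge> tri_power (Suc n - i))" for I
    by (rule zero_mem_sum) (rule zero_mem_lozenge)
  have "t \<bottom> y \<in> span_prod (\<bottom>) (tri_power 1) (tri_power n)"
    unfolding span_prod_def by (rule span_base) (use assms(2) in auto)
  then have "0 + 0 + t \<bottom> y \<in> tri_power 1 \<lozenge> tri_power n"
    unfolding lozenge_prod_def
    by (intro set_plus_intro) (auto simp: span_prod_def span_zero)
  then have "t \<bottom> y + 0 \<in> (tri_power 1 \<lozenge> tri_power (Suc n - 1)) +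
      (\<Sum>i\<in>{1..n} - {1}. tri_power i \<lozenge> tri_power (Suc n - i))"
    using zero by (intro set_plus_intro) auto
  also have "\<dots> = (\<Sum>i = 1..n. tri_power i \<lozenge> tri_power (Suc n - i))"
    using assms(1) by (intro sum.remove[symmetric]) auto
  finally show ?thesis using m by simp
qed

lemma nilpotent_imp_nilpotent_mprod:
  assumes nilpotent
  shows "nilpotent_endo ((\<bottom>) t)"
proof -
  obtain n where n: "1 \<le> n" "tri_power n = {0}" using assms unfolding nilpotent_def by blast
  have "((\<bottom>) t ^^ k) x \<in> tri_power (Suc k)" for k x
    by (induction k) (auto simp: mprod_mem_tri_power simp del: tri_power.simps(3))
  \<comment> \<open>Since \<open>T\<^sup>1 = T\<close>, already \<open>n - 1\<close> applications suffice; the exponent \<open>n\<close> is used because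
    \<open>nilpotent_endo\<close> asks for a positive one.\<close>
  from this[of "n - 1"] have "((\<bottom>) t ^^ (n - 1)) x = 0" for x using n by auto
  moreover have "(\<bottom>) t ^^ n = (\<bottom>) t \<circ> ((\<bottom>) t ^^ (n - 1))"
    using n(1) funpow.simps(2)[of "n - 1" "(\<bottom>) t"] by simp
  ultimately have "(\<bottom>) t ^^ n = (\<lambda>x. 0)" by (auto simp: mprod_zero)
  then show ?thesis unfolding nilpotent_endo_def using n(1) by blast
qed

lemma nilpotent_mprod_imp_nilpotent:
  assumes fin: "finite_dimensional_vector_space scale Basis"
    and nil: "\<And>t. nilpotent_endo ((\<bottom>) t)"
  shows nilpotent
proof -
  have "\<exists>n. vanishing_words mid_ops n"
  proof (rule finite_dimensional_vector_space.nil_operators_vanishing_words[OF fin])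
    show "Vector_Spaces.linear scale scale f" if "f \<in> mid_ops" for f
      using that mprod_linear_right by auto
    show "f \<circ> g \<in> mid_ops" if fg: "f \<in> mid_ops" "g \<in> mid_ops" for f g
    proof -
      obtain a b where "f = (\<bottom>) a" "g = (\<bottom>) b" using fg by blast
      then have "f \<circ> g = (\<bottom>) (a \<bottom> b)" by (auto simp: A3)
      then show ?thesis by blast
    qed
  qed (use subspace_mprod_orbit nil in auto)
  then obtain n where n: "vanishing_words mid_ops n" by blast
  \<comment> \<open>The translation from \<open>\<bottom>\<close> to \<open>\<turnstile>\<close> and \<open>\<stileturn>\<close> costs one letter, so \<open>Suc n\<close> serves as a common
    bound for all three products.\<close>
  let ?N = "Suc n"
  have "vanishing_words (left_ops \<union> mid_ops) (?N * ?N)"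
    using vanishing_left_mid_words[OF vanishing_left_words[OF n]] vanishing_words_le[OF n] by simp
  from tri_power_eq_0[OF this vanishing_right_words[OF n] _ order_refl]
  have "tri_power (?N * ?N + ?N) = {0}" by simp
  then show ?thesis unfolding nilpotent_def by (intro exI[of _ "?N * ?N + ?N"]) simp
qed

end

theorem corollary4p6:
  fixes scale :: "'k::field \<Rightarrow> 'a::ab_group_add \<Rightarrow> 'a"
    and lprod rprod mprod :: "'a \<Rightarrow> 'a \<Rightarrow> 'a"
  assumes "triassociative_algebra scale lprod rprod mprod"
    and "\<exists>Basis. finite_dimensional_vector_space scale Basis"
  shows "triassociative_algebra.nilpotent scale lprod rprod mprod \<longleftrightarrow>
    (\<forall>t. nilpotent_endo (\<lambda>x. mprod t x))"
proof -
  interpret triassociative_algebra scale lprod rprod mprod by (rule assms(1))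
  show ?thesis
    using nilpotent_imp_nilpotent_mprod nilpotent_mprod_imp_nilpotent assms(2) by blast
qed

end
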